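(* Let $(\mathcal{X},\mu)$ be a $\sigma$-finite measure space, let $f_1,\ldots,f_K$ be probability densities on $\mathcal{X}$ with respect to $\mu$, let $\pi_1,\ldots,\pi_K$ be prior probabilities (non-negative with sum one), and let $\varepsilon_1,\ldots,\varepsilon_K$ be given numbers. Assume there exist real numbers $\lambda_1,\ldots,\lambda_K$ such that the classification procedure $\phi^*=(\phi_0^*,\phi_1^*,\ldots,\phi_K^* )$ defined by $$\phi_k^*(x)=I\Big\{H_k(x)=\max_{0\le t\le K}H_t(x)\Big\},\qquad k=0,1,\ldots,K,$$ belongs to $\mathcal{C}_0$, where $$H_k(x)=(\pi_k+\lambda_k)f_k(x),\quad k=1,\ldots,K,\qquad H_0(x)=\sum_{k=1}^K\lambda_kf_k(x).$$ (If more than one $k$ achieves $H_k(x)=\max_{0\le t\le K}H_t(x)$, then $x$ is assigned to exactly one of these, for example the one with lowest label, so that exactly one of the $\phi_k^*(x)$ equals $1$ and the others equal $0$.) Then $\phi^*$ maximises the success probability $$\mathrm{pcc}(\phi)=\sum_{k=1}^K\pi_k\int\phi_kf_k\,d\mu$$ among all procedures $\phi$ in $\mathcal{C}_0$. Further, if the $\lambda_k$'s are non-negative, then $\phi^*$ also maximises $\mathrm{pcc}(\phi)$ among all procedures $\phi$ in $\mathcal{C}$.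
   Context: A (randomised) classification procedure is a (measurable) function $\phi(x)=(\phi_0(x),\phi_1(x),\ldots,\phi_K(x))$ on $\mathcal{X}$ whose components are non-negative and sum to one for every $x$. Here $\phi_k(x)$, $1\le k\le K$, is the probability of deciding on class $k$ when $X=x$ is observed, and $\phi_0(x)$ is the probability of deciding on ``doubt''. A vector $X$ from class $k$ has density $f_k$ with respect to $\mu$. The misclassification probability for class $k$ is $$\mathrm{pmc}(k)=\int\sum_{1\le t\le K,\;t\ne k}\phi_tf_k\,d\mu .$$ For the given numbers $\varepsilon_1,\ldots,\varepsilon_K$, $\mathcal{C}$ is the class of all procedures $\phi$ with $\mathrm{pmc}(k)\le\varepsilon_k$ for all $k=1,\ldots,K$, and $\mathcal{C}_0$ is the subclass of procedures with $\mathrm{pmc}(k)=\varepsilon_k$ for all $k=1,\ldots,K$. $I\{\cdot\}$ denotes the indicator function. *)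

theory Defs
  imports "HOL-Analysis.Analysis"
begin

text \<open>
  Classes are labelled \<open>1, \<dots>, K\<close> and the label \<open>0\<close> stands for doubt. A procedure is a family
  \<open>\<phi> :: nat \<Rightarrow> 'a \<Rightarrow> real\<close> of which only the components \<open>\<phi> 0, \<dots>, \<phi> K\<close> on \<open>space M\<close> matter; likewise only
  the values at \<open>1, \<dots>, K\<close> of the families indexed by classes matter.
\<close>

definition prob_density :: "'a measure \<Rightarrow> ('a \<Rightarrow> real) \<Rightarrow> bool" where
  "prob_density M g \<longleftrightarrow>
     g \<in> borel_measurable M \<and> (\<forall>x\<in>space M. 0 \<le> g x) \<and> (\<integral>\<^sup>+x. ennreal (g x) \<partial>M) = 1"

definition procedure :: "'a measure \<Rightarrow> nat \<Rightarrow> (nat \<Rightarrow> 'a \<Rightarrow> real) \<Rightarrow> bool" where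
  "procedure M K \<phi> \<longleftrightarrow>
     (\<forall>k\<in>{0..K}. \<phi> k \<in> borel_measurable M) \<and>
     (\<forall>x\<in>space M. (\<forall>k\<in>{0..K}. 0 \<le> \<phi> k x) \<and> (\<Sum>k=0..K. \<phi> k x) = 1)"

definition pmc :: "'a measure \<Rightarrow> nat \<Rightarrow> (nat \<Rightarrow> 'a \<Rightarrow> real) \<Rightarrow> (nat \<Rightarrow> 'a \<Rightarrow> real) \<Rightarrow> nat \<Rightarrow> real" where
  "pmc M K f \<phi> k = (\<integral>x. (\<Sum>t\<in>{1..K} - {k}. \<phi> t x * f k x) \<partial>M)"

definition pcc ::
  "'a measure \<Rightarrow> nat \<Rightarrow> (nat \<Rightarrow> real) \<Rightarrow> (nat \<Rightarrow> 'a \<Rightarrow> real) \<Rightarrow> (nat \<Rightarrow> 'a \<Rightarrow> real) \<Rightarrow> real" where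
  "pcc M K \<pi> f \<phi> = (\<Sum>k=1..K. \<pi> k * (\<integral>x. \<phi> k x * f k x \<partial>M))"

definition class_C ::
  "'a measure \<Rightarrow> nat \<Rightarrow> (nat \<Rightarrow> 'a \<Rightarrow> real) \<Rightarrow> (nat \<Rightarrow> real) \<Rightarrow> (nat \<Rightarrow> 'a \<Rightarrow> real) set" where
  "class_C M K f \<epsilon> = {\<phi>. procedure M K \<phi> \<and> (\<forall>k\<in>{1..K}. pmc M K f \<phi> k \<le> \<epsilon> k)}"

definition class_C0 ::
  "'a measure \<Rightarrow> nat \<Rightarrow> (nat \<Rightarrow> 'a \<Rightarrow> real) \<Rightarrow> (nat \<Rightarrow> real) \<Rightarrow> (nat \<Rightarrow> 'a \<Rightarrow> real) set" where
  "class_C0 M K f \<epsilon> = {\<phi>. procedure M K \<phi> \<and> (\<forall>k\<in>{1..K}. pmc M K f \<phi> k = \<epsilon> k)}"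

definition H ::
  "nat \<Rightarrow> (nat \<Rightarrow> real) \<Rightarrow> (nat \<Rightarrow> real) \<Rightarrow> (nat \<Rightarrow> 'a \<Rightarrow> real) \<Rightarrow> nat \<Rightarrow> 'a \<Rightarrow> real" where
  "H K \<pi> l f k x = (if k = 0 then (\<Sum>j=1..K. l j * f j x) else (\<pi> k + l k) * f k x)"

text \<open>
  The rule \<open>\<phi>\<^sub>k(x) = I{h\<^sub>k(x) = max\<^sub>t h\<^sub>t(x)}\<close>, where a point with several maximising labels is assigned
  to exactly one of them. Which one is left open, so assignment to the lowest label is one instance
  and every other way of breaking ties is covered too. Measurability of the resulting \<open>\<phi>\<close> is not
  part of this predicate, but of \<^const>\<open>procedure\<close>.
\<close>

definition max_rule ::
  "'a measure \<Rightarrow> nat \<Rightarrow> (nat \<Rightarrow> 'a \<Rightarrow> real) \<Rightarrow> (nat \<Rightarrow> 'a \<Rightarrow> real) \<Rightarrow> bool" where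
  "max_rule M K h \<phi> \<longleftrightarrow>
     (\<forall>x\<in>space M. \<exists>k\<in>{0..K}. h k x = Max ((\<lambda>t. h t x) ` {0..K}) \<and>
        (\<forall>j\<in>{0..K}. \<phi> j x = (if j = k then 1 else 0)))"

end

theory Submission imports Defs begin

text \<open>
  The numbers \<open>l k\<close> act as Lagrange multipliers for the constraints on the misclassification
  probabilities. Adding \<open>\<Sum>k. l k * (1 - pmc k)\<close> to the success probability gives a functional whose
  integrand at \<open>x\<close> is the average of \<open>H 0 x, \<dots>, H K x\<close> with weights \<open>\<phi> 0 x, \<dots>, \<phi> K x\<close>: not being
  misclassified means being assigned to the own class or to doubt, which is why
  \<open>H 0\<close> collects all the terms \<open>l k * f k\<close> (lemma \<open>integral_weighted_H\<close>). Such an average is at most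
  the maximum of the \<open>H t x\<close>, and the maximum rule attains it, so the rule maximises the functional
  over all procedures, without any constraint. Passing back to the success probability costs
  \<open>\<Sum>k. l k * (pmc k \<phi> - pmc k \<phi>s)\<close>. This vanishes when both procedures meet the constraints with
  equality; it is non-positive when the multipliers are non-negative, \<open>\<phi>\<close> satisfies the constraints
  and \<open>\<phi>s\<close> attains them (lemma \<open>max_rule_maximises_pcc\<close>).
\<close>

lemma procedure_measurable:
  assumes "procedure M K \<phi>" "t \<le> K"
  shows "\<phi> t \<in> borel_measurable M"
  using assms by (auto simp: procedure_def)

lemma procedure_nonneg:
  assumes "procedure M K \<phi>" "t \<le> K" "x \<in> space M"
  shows "0 \<le> \<phi> t x"
  using assms by (auto simp: procedure_def)

lemma procedure_sum:
  assumes "procedure M K \<phi>" "x \<in> space M"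
  shows "(\<Sum>t=0..K. \<phi> t x) = 1"
  using assms by (auto simp: procedure_def)

lemma procedure_le_1:
  assumes "procedure M K \<phi>" "t \<le> K" "x \<in> space M"
  shows "\<phi> t x \<le> 1"
proof -
  have "\<phi> t x \<le> (\<Sum>s=0..K. \<phi> s x)"
    using assms by (intro member_le_sum) (auto intro: procedure_nonneg)
  then show ?thesis
    using procedure_sum[OF assms(1,3)] by simp
qed

lemma prob_density_integrable:
  assumes "prob_density M g"
  shows "integrable M g"
  using assms by (intro integrableI_nonneg) (auto simp: prob_density_def)

lemma prob_density_integral:
  assumes "prob_density M g"
  shows "(\<integral>x. g x \<partial>M) = 1"
  using assms by (subst integral_eq_nn_integral) (auto simp: prob_density_def)

lemma procedure_times_density_integrable:
  assumes "procedure M K \<phi>" "t \<le> K" "prob_density M g"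
  shows "integrable M (\<lambda>x. \<phi> t x * g x)"
proof (rule Bochner_Integration.integrable_bound[OF prob_density_integrable[OF assms(3)]])
  show "(\<lambda>x. \<phi> t x * g x) \<in> borel_measurable M"
    using procedure_measurable[OF assms(1,2)] assms(3)
    by (auto simp: prob_density_def)
  show "AE x in M. norm (\<phi> t x * g x) \<le> norm (g x)"
  proof (rule AE_I2)
    fix x assume x: "x \<in> space M"
    have "\<bar>\<phi> t x\<bar> * \<bar>g x\<bar> \<le> 1 * \<bar>g x\<bar>"
      using procedure_nonneg[OF assms(1,2) x] procedure_le_1[OF assms(1,2) x]
      by (intro mult_right_mono) auto
    then show "norm (\<phi> t x * g x) \<le> norm (g x)"
      by (simp add: abs_mult)
  qed
qed

text \<open>
  Since the components of a procedure sum to one, the doubt weight \<open>\<phi> 0\<close> together with \<open>\<phi> k\<close> is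
  the complement of the weights that misclassify class \<open>k\<close>. This turns the \<open>l k\<close> terms of the
  average into the integrands of \<open>1 - pmc k\<close>.
\<close>

lemma weighted_H:
  assumes "procedure M K \<phi>" "x \<in> space M"
  shows "(\<Sum>t=0..K. \<phi> t x * H K \<pi> l f t x) =
    (\<Sum>k=1..K. \<pi> k * (\<phi> k x * f k x)
       + l k * (f k x - (\<Sum>t\<in>{1..K} - {k}. \<phi> t x * f k x)))"
proof -
  have split0: "(\<Sum>t=0..K. g t) = g 0 + (\<Sum>t=1..K. g t)" for g :: "nat \<Rightarrow> real"
    by (simp add: sum.atLeast_Suc_atMost)
  have compl: "f k x - (\<Sum>t\<in>{1..K} - {k}. \<phi> t x * f k x) = (\<phi> 0 x + \<phi> k x) * f k x"
    if k: "k \<in> {1..K}" for k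
  proof -
    have "(\<Sum>t\<in>{1..K}. \<phi> t x) = \<phi> k x + (\<Sum>t\<in>{1..K} - {k}. \<phi> t x)"
      using k by (intro sum.remove) auto
    then have "1 - (\<Sum>t\<in>{1..K} - {k}. \<phi> t x) = \<phi> 0 x + \<phi> k x"
      using procedure_sum[OF assms] split0[of "\<lambda>t. \<phi> t x"] by linarith
    moreover have "f k x - (\<Sum>t\<in>{1..K} - {k}. \<phi> t x * f k x) =
        (1 - (\<Sum>t\<in>{1..K} - {k}. \<phi> t x)) * f k x"
      by (simp only: sum_distrib_right[symmetric] left_diff_distrib mult_1_left)
    ultimately show ?thesis
      by (simp only:)
  qed
  have "(\<Sum>t=0..K. \<phi> t x * H K \<pi> l f t x) =
      \<phi> 0 x * (\<Sum>k=1..K. l k * f k x) + (\<Sum>k=1..K. \<phi> k x * ((\<pi> k + l k) * f k x))"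
    unfolding split0 by (simp add: H_def)
  also have "\<dots> = (\<Sum>k=1..K. \<pi> k * (\<phi> k x * f k x) + l k * ((\<phi> 0 x + \<phi> k x) * f k x))"
    by (simp add: sum_distrib_left sum.distrib[symmetric] algebra_simps)
  also have "\<dots> = (\<Sum>k=1..K. \<pi> k * (\<phi> k x * f k x)
       + l k * (f k x - (\<Sum>t\<in>{1..K} - {k}. \<phi> t x * f k x)))"
    by (intro sum.cong) (simp_all only: compl)
  finally show ?thesis .
qed

lemma weighted_H_integrable:
  assumes "procedure M K \<phi>" "\<And>k. k \<in> {1..K} \<Longrightarrow> prob_density M (f k)"
  shows "integrable M (\<lambda>x. \<Sum>t=0..K. \<phi> t x * H K \<pi> l f t x)"
proof -
  have "integrable M (\<lambda>x. \<Sum>k=1..K. \<pi> k * (\<phi> k x * f k x)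
       + l k * (f k x - (\<Sum>t\<in>{1..K} - {k}. \<phi> t x * f k x)))"
    using assms
    by (intro Bochner_Integration.integrable_sum Bochner_Integration.integrable_add
        Bochner_Integration.integrable_diff integrable_mult_right prob_density_integrable
        procedure_times_density_integrable[OF assms(1)]) auto
  then show ?thesis
    by (subst Bochner_Integration.integrable_cong[OF refl weighted_H[OF assms(1)]])
qed

text \<open>The integrated average is the Lagrangian of the constrained maximisation problem.\<close>

lemma integral_weighted_H:
  assumes "procedure M K \<phi>" "\<And>k. k \<in> {1..K} \<Longrightarrow> prob_density M (f k)"
  shows "(\<integral>x. (\<Sum>t=0..K. \<phi> t x * H K \<pi> l f t x) \<partial>M) =
    pcc M K \<pi> f \<phi> + (\<Sum>k=1..K. l k * (1 - pmc M K f \<phi> k))"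
proof -
  have int_f: "integrable M (f k)" if "k \<in> {1..K}" for k
    using assms(2)[OF that] by (rule prob_density_integrable)
  have int_prod: "integrable M (\<lambda>x. \<phi> t x * f k x)" if "t \<in> {1..K}" "k \<in> {1..K}" for t k
    using that assms by (intro procedure_times_density_integrable[OF assms(1)]) auto
  have int_err: "integrable M (\<lambda>x. \<Sum>t\<in>{1..K} - {k}. \<phi> t x * f k x)" if "k \<in> {1..K}" for k
    using that by (intro Bochner_Integration.integrable_sum int_prod) auto
  have "(\<integral>x. (\<Sum>t=0..K. \<phi> t x * H K \<pi> l f t x) \<partial>M) =
      (\<integral>x. (\<Sum>k=1..K. \<pi> k * (\<phi> k x * f k x)
       + l k * (f k x - (\<Sum>t\<in>{1..K} - {k}. \<phi> t x * f k x))) \<partial>M)"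
    by (intro Bochner_Integration.integral_cong refl weighted_H[OF assms(1)])
  also have "\<dots> = (\<Sum>k=1..K. \<integral>x. (\<pi> k * (\<phi> k x * f k x)
       + l k * (f k x - (\<Sum>t\<in>{1..K} - {k}. \<phi> t x * f k x))) \<partial>M)"
    by (intro Bochner_Integration.integral_sum Bochner_Integration.integrable_add
        Bochner_Integration.integrable_diff integrable_mult_right int_f int_prod int_err)
  also have "\<dots> = (\<Sum>k=1..K. \<pi> k * (\<integral>x. \<phi> k x * f k x \<partial>M) + l k * (1 - pmc M K f \<phi> k))"
  proof (rule sum.cong[OF refl])
    fix k assume k: "k \<in> {1..K}"
    show "(\<integral>x. (\<pi> k * (\<phi> k x * f k x)
       + l k * (f k x - (\<Sum>t\<in>{1..K} - {k}. \<phi> t x * f k x))) \<partial>M) =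
       \<pi> k * (\<integral>x. \<phi> k x * f k x \<partial>M) + l k * (1 - pmc M K f \<phi> k)"
      using int_f[OF k] int_prod[OF k k] int_err[OF k] prob_density_integral[OF assms(2)[OF k]]
      by (simp add: pmc_def)
  qed
  also have "\<dots> = pcc M K \<pi> f \<phi> + (\<Sum>k=1..K. l k * (1 - pmc M K f \<phi> k))"
    by (simp add: pcc_def sum.distrib)
  finally show ?thesis .
qed

text \<open>
  A convex combination of values is at most their maximum; the maximum rule puts all its weight
  on a maximising label, whichever way ties are broken.
\<close>

lemma weighted_le_max_rule:
  assumes "procedure M K \<phi>" "max_rule M K h \<phi>s" "x \<in> space M"
  shows "(\<Sum>t=0..K. \<phi> t x * h t x) \<le> (\<Sum>t=0..K. \<phi>s t x * h t x)"
proof -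
  obtain k where k: "k \<in> {0..K}" "h k x = Max ((\<lambda>t. h t x) ` {0..K})"
    and \<phi>s: "\<And>j. j \<in> {0..K} \<Longrightarrow> \<phi>s j x = (if j = k then 1 else 0)"
    using assms(2,3) unfolding max_rule_def by blast
  have "(\<Sum>t=0..K. \<phi> t x * h t x) \<le> (\<Sum>t=0..K. \<phi> t x * h k x)"
  proof (rule sum_mono)
    fix t assume t: "t \<in> {0..K}"
    then have "h t x \<le> h k x"
      unfolding k(2) by (intro Max_ge) auto
    then show "\<phi> t x * h t x \<le> \<phi> t x * h k x"
      using t assms by (intro mult_left_mono) (auto intro: procedure_nonneg)
  qed
  also have "\<dots> = h k x"
    using procedure_sum[OF assms(1,3)] by (simp add: sum_distrib_right[symmetric])
  also have "\<dots> = (\<Sum>t=0..K. if t = k then h t x else 0)"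
    using k(1) by simp
  also have "\<dots> = (\<Sum>t=0..K. \<phi>s t x * h t x)"
    by (intro sum.cong) (auto simp: \<phi>s)
  finally show ?thesis .
qed

text \<open>
  This is weak duality. The hypothesis weighted by \<open>l k\<close> covers both classes at once: it is an
  equality, for any sign of \<open>l k\<close>, if the two procedures have the same misclassification
  probabilities, and it follows from \<open>0 \<le> l k\<close> if those of \<open>\<phi>\<close> are no larger.
\<close>

lemma max_rule_maximises_pcc:
  assumes dens: "\<And>k. k \<in> {1..K} \<Longrightarrow> prob_density M (f k)"
    and rule: "max_rule M K (H K \<pi> l f) \<phi>s"
    and procs: "procedure M K \<phi>s" "procedure M K \<phi>"
    and constraint: "\<And>k. k \<in> {1..K} \<Longrightarrow> l k * pmc M K f \<phi> k \<le> l k * pmc M K f \<phi>s k"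
  shows "pcc M K \<pi> f \<phi> \<le> pcc M K \<pi> f \<phi>s"
proof -
  have "(\<integral>x. (\<Sum>t=0..K. \<phi> t x * H K \<pi> l f t x) \<partial>M)
      \<le> (\<integral>x. (\<Sum>t=0..K. \<phi>s t x * H K \<pi> l f t x) \<partial>M)"
    by (intro integral_mono weighted_H_integrable procs dens weighted_le_max_rule[OF procs(2) rule])
  then have "pcc M K \<pi> f \<phi> + (\<Sum>k=1..K. l k * (1 - pmc M K f \<phi> k))
      \<le> pcc M K \<pi> f \<phi>s + (\<Sum>k=1..K. l k * (1 - pmc M K f \<phi>s k))"
    using integral_weighted_H[of M K, OF procs(1) dens] integral_weighted_H[of M K, OF procs(2) dens]
    by simp
  moreover have "(\<Sum>k=1..K. l k * (1 - pmc M K f \<phi>s k)) \<le> (\<Sum>k=1..K. l k * (1 - pmc M K f \<phi> k))"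
    using constraint by (intro sum_mono) (simp add: algebra_simps)
  ultimately show ?thesis
    by linarith
qed

theorem mainTheorem1:
  fixes M :: "'a measure" and K :: nat
    and f :: "nat \<Rightarrow> 'a \<Rightarrow> real" and \<pi> \<epsilon> l :: "nat \<Rightarrow> real"
    and \<phi>s :: "nat \<Rightarrow> 'a \<Rightarrow> real"
  assumes "sigma_finite_measure M"
    and "\<And>k. k \<in> {1..K} \<Longrightarrow> prob_density M (f k)"
    and "\<And>k. k \<in> {1..K} \<Longrightarrow> 0 \<le> \<pi> k"
    and "(\<Sum>k=1..K. \<pi> k) = 1"
    and "max_rule M K (H K \<pi> l f) \<phi>s"
    and "\<phi>s \<in> class_C0 M K f \<epsilon>"
  shows "is_arg_max (pcc M K \<pi> f) (\<lambda>\<phi>. \<phi> \<in> class_C0 M K f \<epsilon>) \<phi>s \<and>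
    ((\<forall>k\<in>{1..K}. 0 \<le> l k) \<longrightarrow>
      is_arg_max (pcc M K \<pi> f) (\<lambda>\<phi>. \<phi> \<in> class_C M K f \<epsilon>) \<phi>s)"
proof -
  have proc: "procedure M K \<phi>s" and eq: "\<And>k. k \<in> {1..K} \<Longrightarrow> pmc M K f \<phi>s k = \<epsilon> k"
    using assms(6) by (auto simp: class_C0_def)
  have C0: "pcc M K \<pi> f \<phi> \<le> pcc M K \<pi> f \<phi>s" if "\<phi> \<in> class_C0 M K f \<epsilon>" for \<phi>
    using that eq by (intro max_rule_maximises_pcc[OF assms(2,5) proc]) (auto simp: class_C0_def)
  have C: "pcc M K \<pi> f \<phi> \<le> pcc M K \<pi> f \<phi>s"
    if "\<forall>k\<in>{1..K}. 0 \<le> l k" "\<phi> \<in> class_C M K f \<epsilon>" for \<phi>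
    using that eq
    by (intro max_rule_maximises_pcc[OF assms(2,5) proc]) (auto simp: class_C_def intro!: mult_left_mono)
  have "\<phi>s \<in> class_C M K f \<epsilon>"
    using proc eq by (simp add: class_C_def)
  then show ?thesis
    using assms(6) C0 C by (auto simp: is_arg_max_linorder)
qed

end
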